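(* Let $G$ be a graph with an even Hamiltonian circuit $C$ such that the spanning subgraph $G\setminus E(C)$ is bipartite. If $G\setminus E(C)$ has an oriented cycle double cover, then $G$ has a $2$-simultaneous edge coloring.
   Context: All graphs are finite and simple; $[l]=\{1,\ldots,l\}$. A circuit is a connected $2$-regular subgraph; an even Hamiltonian circuit is a circuit through all vertices of $G$ of even length. An oriented cycle double cover of a graph $H$ is a collection (multiset) of circuits of $H$ such that every edge of $H$ lies in exactly two of them, and each circuit can be given a cyclic orientation so that every edge of $H$ is traversed by its two covering directed circuits in opposite directions. A $2$-simultaneous edge coloring of $G$ is a pair $(c_1,c_2)$ of proper edge colorings $c_i:E(G)\to[l]$ with a common color set such that for every vertex $v$ the sets of colors on edges incident to $v$ are the same under $c_1$ and $c_2$, and $c_1(e)\ne c_2(e)$ for every edge $e$. *)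

theory Defs
  imports Main "HOL-Library.Multiset"
begin

datatype 'a graph = Graph (verts: "'a set") (edges: "'a set set")

definition simple_graph :: "'a graph \<Rightarrow> bool" where
  "simple_graph G \<longleftrightarrow> finite (verts G) \<and> (\<forall>e\<in>edges G. e \<subseteq> verts G \<and> card e = 2)"

definition subgraph :: "'a graph \<Rightarrow> 'a graph \<Rightarrow> bool" where
  "subgraph H G \<longleftrightarrow> simple_graph H \<and> verts H \<subseteq> verts G \<and> edges H \<subseteq> edges G"

definition incident_edges :: "'a graph \<Rightarrow> 'a \<Rightarrow> 'a set set" where
  "incident_edges G v = {e \<in> edges G. v \<in> e}"

definition connected_graph :: "'a graph \<Rightarrow> bool" where
  "connected_graph G \<longleftrightarrow> verts G \<noteq> {} \<and>
     (\<forall>u\<in>verts G. \<forall>v\<in>verts G. (u, v) \<in> {(x, y). {x, y} \<in> edges G}\<^sup>*)"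

definition bipartite :: "'a graph \<Rightarrow> bool" where
  "bipartite G \<longleftrightarrow> (\<exists>X Y. X \<union> Y = verts G \<and> X \<inter> Y = {} \<and>
     (\<forall>e\<in>edges G. \<exists>x\<in>X. \<exists>y\<in>Y. e = {x, y}))"

definition delete_edges :: "'a graph \<Rightarrow> 'a set set \<Rightarrow> 'a graph" where
  "delete_edges G F = Graph (verts G) (edges G - F)"

definition circuit :: "'a graph \<Rightarrow> 'a graph \<Rightarrow> bool" where
  "circuit G C \<longleftrightarrow> subgraph C G \<and> connected_graph C \<and>
     (\<forall>v\<in>verts C. card (incident_edges C v) = 2)"

definition even_hamiltonian_circuit :: "'a graph \<Rightarrow> 'a graph \<Rightarrow> bool" where
  "even_hamiltonian_circuit G C \<longleftrightarrow>
     circuit G C \<and> verts C = verts G \<and> even (card (edges C))"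

text \<open>An orientation of a circuit is given by its set of arcs: every edge gets exactly one
  of its two directions, and it is cyclic if every vertex is entered once and left once.\<close>

definition cyclic_orientation :: "'a graph \<Rightarrow> ('a \<times> 'a) set \<Rightarrow> bool" where
  "cyclic_orientation C A \<longleftrightarrow>
     {{u, v} |u v. (u, v) \<in> A} = edges C \<and>
     (\<forall>u v. (u, v) \<in> A \<longrightarrow> (v, u) \<notin> A) \<and>
     (\<forall>v\<in>verts C. (\<exists>!u. (u, v) \<in> A) \<and> (\<exists>!w. (v, w) \<in> A))"

text \<open>The multiset \<open>D\<close> pairs each member of \<open>M\<close>, counted with multiplicity, with an
  orientation of its own, so two copies of the same circuit may be oriented differently.\<close>

definition oriented_cycle_double_cover :: "'a graph \<Rightarrow> 'a graph multiset \<Rightarrow> bool" where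
  "oriented_cycle_double_cover H M \<longleftrightarrow>
     (\<forall>C\<in>#M. circuit H C) \<and>
     (\<forall>e\<in>edges H. size {#C \<in># M. e \<in> edges C#} = 2) \<and>
     (\<exists>D :: ('a graph \<times> ('a \<times> 'a) set) multiset.
        image_mset fst D = M \<and>
        (\<forall>X\<in>#D. cyclic_orientation (fst X) (snd X)) \<and>
        (\<forall>u v. {u, v} \<in> edges H \<longrightarrow>
           (\<exists>X Y. {#Z \<in># D. {u, v} \<in> edges (fst Z)#} = {#X, Y#} \<and>
                  (u, v) \<in> snd X \<and> (v, u) \<in> snd Y)))"

definition proper_edge_coloring :: "'a graph \<Rightarrow> nat \<Rightarrow> ('a set \<Rightarrow> nat) \<Rightarrow> bool" where
  "proper_edge_coloring G l c \<longleftrightarrow>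
     c ` edges G \<subseteq> {1..l} \<and>
     (\<forall>e\<in>edges G. \<forall>f\<in>edges G. e \<noteq> f \<and> e \<inter> f \<noteq> {} \<longrightarrow> c e \<noteq> c f)"

definition two_simultaneous_edge_coloring ::
  "'a graph \<Rightarrow> nat \<Rightarrow> ('a set \<Rightarrow> nat) \<Rightarrow> ('a set \<Rightarrow> nat) \<Rightarrow> bool" where
  "two_simultaneous_edge_coloring G l c1 c2 \<longleftrightarrow>
     proper_edge_coloring G l c1 \<and> proper_edge_coloring G l c2 \<and>
     (\<forall>v\<in>verts G. c1 ` incident_edges G v = c2 ` incident_edges G v) \<and>
     (\<forall>e\<in>edges G. c1 e \<noteq> c2 e)"

end

(* An edge xy of the bipartite graph H, with x in the part X, is traversed from x to y by exactly
   one member of the cover and from y to x by exactly one other. Taking these two members as the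
   two colours of xy, a colour sits on the edge on which a circuit leaves x in one colouring and on
   which it enters x in the other; hence both colourings are proper, and both show at every vertex
   exactly the members of the cover that pass through it. The even circuit C is coloured alternately
   with two further colours, which are exchanged in the second colouring. *)
theory Submission
  imports Defs
begin

section \<open>Alternating colourings of even circuits\<close>

text \<open>A circuit is given only as a connected 2-regular graph; this walk supplies a listing of
  it. Each vertex has a second edge to leave by, so the walk never has to stop or turn back. It is
  infinite, and its period is found afterwards.\<close>

lemma two_regular_walk:
  assumes "simple_graph C" and reg: "\<forall>v\<in>verts C. card (incident_edges C v) = 2"
    and "v0 \<in> verts C"
  obtains p :: "nat \<Rightarrow> 'a" where "p 0 = v0" "\<And>n. {p n, p (Suc n)} \<in> edges C"
    "\<And>n. p (Suc (Suc n)) \<noteq> p n"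
proof -
  \<comment> \<open>Here \<open>u\<close> is the vertex just left: of two distinct edges at
    \<open>v\<close>, at most one leads to it.\<close>
  have other: "\<exists>w. {v, w} \<in> edges C \<and> w \<noteq> u" if "v \<in> verts C" for u v
  proof -
    have "card (incident_edges C v) = 2" using reg that by blast
    then obtain e f where ef: "e \<noteq> f" "incident_edges C v = {e, f}"
      by (auto simp: card_2_iff)
    then have inc: "e \<in> incident_edges C v" "f \<in> incident_edges C v" by simp_all
    have edge: "d \<in> edges C" "\<exists>w. d = {v, w}" if "d \<in> incident_edges C v" for d
      using that assms(1) by (auto simp: incident_edges_def simple_graph_def card_2_iff)
    obtain a b where "e = {v, a}" "f = {v, b}" using edge(2) inc by meson
    then show ?thesis using edge(1)[OF inc(1)] edge(1)[OF inc(2)] ef(1) by metis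
  qed
  have vert: "b \<in> verts C" if "{a, b} \<in> edges C" for a b
    using that assms(1) by (auto simp: simple_graph_def)
  obtain v1 where v1: "{v0, v1} \<in> edges C" using other[OF assms(3)] by blast
  \<comment> \<open>The next vertex depends on the last two, so the choice runs over directed edges
    \<open>(p n, p (Suc n))\<close>.\<close>
  have "\<exists>f. \<forall>n. ({fst (f n), snd (f n)} \<in> edges C \<and> (n = 0 \<longrightarrow> fst (f n) = v0)) \<and>
      (fst (f (Suc n)) = snd (f n) \<and> snd (f (Suc n)) \<noteq> fst (f n))"
  proof (rule dependent_nat_choice)
    show "\<exists>x. {fst x, snd x} \<in> edges C \<and> ((0::nat) = 0 \<longrightarrow> fst x = v0)"
      using v1 by (intro exI[of _ "(v0, v1)"]) simp
  next
    fix x and n :: nat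
    assume "{fst x, snd x} \<in> edges C \<and> (n = 0 \<longrightarrow> fst x = v0)"
    then obtain w where "{snd x, w} \<in> edges C" "w \<noteq> fst x" using other vert by metis
    then show "\<exists>y. ({fst y, snd y} \<in> edges C \<and> (Suc n = 0 \<longrightarrow> fst y = v0)) \<and>
        fst y = snd x \<and> snd y \<noteq> fst x"
      by (intro exI[of _ "(snd x, w)"]) simp
  qed
  then obtain f where f: "\<And>n. {fst (f n), snd (f n)} \<in> edges C" "fst (f 0) = v0"
    "\<And>n. fst (f (Suc n)) = snd (f n)" "\<And>n. snd (f (Suc n)) \<noteq> fst (f n)" by metis
  show ?thesis
  proof (rule that[of "\<lambda>n. fst (f n)"])
    show "{fst (f n), fst (f (Suc n))} \<in> edges C" "fst (f (Suc (Suc n))) \<noteq> fst (f n)" for n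
      unfolding f(3) using f(1,4) by blast+
  qed (fact f(2))
qed

text \<open>The walk closes up at its start after \<open>k\<close> steps and by then has used every
  edge of \<open>C\<close> exactly once. Hence \<open>k\<close> is even, and colouring each edge by
  the parity of its index alternates all the way round.\<close>

lemma even_circuit_alternating:
  assumes circ: "circuit G C" and even: "even (card (edges C))"
  obtains c :: "'a set \<Rightarrow> bool"
  where "\<And>v. v \<in> verts C \<Longrightarrow> \<exists>e f. incident_edges C v = {e, f} \<and> c e \<noteq> c f"
proof -
  have simple: "simple_graph C" and conn: "connected_graph C"
    and reg: "\<forall>v\<in>verts C. card (incident_edges C v) = 2"
    using circ by (auto simp: circuit_def subgraph_def)
  obtain v0 where v0: "v0 \<in> verts C" using conn by (auto simp: connected_graph_def)
  from two_regular_walk[OF simple reg v0] obtain p where p0: "p 0 = v0"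
    and adj: "\<And>n. {p n, p (Suc n)} \<in> edges C" and turn: "\<And>n. p (Suc (Suc n)) \<noteq> p n"
    by blast
  have vert: "a \<in> verts C" "b \<in> verts C" "a \<noteq> b" if "{a, b} \<in> edges C" for a b
    using that simple by (auto simp: simple_graph_def)
  have inc: "incident_edges C v = {{v, a}, {v, b}}"
    if "{v, a} \<in> edges C" "{v, b} \<in> edges C" "a \<noteq> b" for v a b
  proof (rule card_seteq[symmetric])
    have "card (incident_edges C v) = 2" using reg vert that by blast
    then show "finite (incident_edges C v)"
      "card (incident_edges C v) \<le> card {{v, a}, {v, b}}"
      using \<open>a \<noteq> b\<close> by (auto simp: doubleton_eq_iff card_ge_0_finite)
  qed (use that in \<open>auto simp: incident_edges_def\<close>)
  have nbr: "c = a \<or> c = b"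
    if "{v, a} \<in> edges C" "{v, b} \<in> edges C" "a \<noteq> b" "{v, c} \<in> edges C" for v a b c
  proof -
    have "{v, c} \<in> incident_edges C v" using that by (simp add: incident_edges_def)
    then show ?thesis using inc[OF that(1-3)] by (auto simp: doubleton_eq_iff)
  qed
  have adj': "{p (Suc n), p n} \<in> edges C" for n using adj[of n] by (simp add: insert_commute)
  have repeats: "\<exists>k. \<exists>j<k. p j = p k"
  proof -
    have "range p \<subseteq> verts C" using adj vert by blast
    then have "finite (range p)" using simple finite_subset by (auto simp: simple_graph_def)
    then have "\<not> inj p" using finite_imageD infinite_UNIV_nat by blast
    then obtain a b where "a \<noteq> b" "p a = p b" by (auto simp: inj_def)
    then show ?thesis by (metis nat_neq_iff)
  qed
  \<comment> \<open>The first return to an earlier vertex; the vertices at indices below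
    \<open>k\<close> are distinct.\<close>
  define k where "k = (LEAST k. \<exists>j<k. p j = p k)"
  have k: "\<exists>j<k. p j = p k" using repeats unfolding k_def by (rule LeastI_ex)
  have least: "\<not> (\<exists>j<m. p j = p m)" if "m < k" for m
    using that unfolding k_def by (rule not_less_Least)
  have inj: "i = j" if "i < k" "j < k" "p i = p j" for i j
    using least that by (metis nat_neq_iff)
  obtain j where j: "j < k" "p j = p k" using k by blast
  have jk: "Suc j < k" "Suc (Suc j) \<noteq> k"
    using j vert(3)[OF adj[of j]] turn[of j] by (metis Suc_lessI, metis)
  obtain l where l: "k = Suc l" using j by (cases k) auto
  \<comment> \<open>If the return were to a later vertex than the start, that vertex would have the
    neighbours \<open>p i\<close>, \<open>p (Suc j)\<close> and \<open>p l\<close>. By 2-regularity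
    two of them coincide, against the distinctness below \<open>k\<close>.\<close>
  have "j = 0"
  proof (rule ccontr)
    assume "j \<noteq> 0"
    then obtain i where i: "j = Suc i" by (cases j) auto
    have "{p (Suc i), p l} \<in> edges C" using adj'[of l] j l i by simp
    then have "p l = p i \<or> p l = p (Suc j)"
      using nbr[OF adj'[of i] adj[of "Suc i"]] turn[of i] i by auto
    then have "l = i \<or> l = Suc j" using inj[of l i] inj[of l "Suc j"] jk l i by auto
    then show False using jk l i by auto
  qed
  then have pk: "p k = p 0" and l2: "Suc 0 < l" using j jk l by auto
  define e where "e i = {p i, p (Suc i)}" for i
  \<comment> \<open>The predecessor modulo \<open>k\<close>: index 0 wraps round to
    \<open>l\<close>, which is \<open>k - 1\<close>.\<close>
  define pre where "pre i = (case i of 0 \<Rightarrow> l | Suc i' \<Rightarrow> i')" for i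
  have at: "incident_edges C (p i) = {e i, e (pre i)}" if "i < k" for i
  proof (cases i)
    case 0
    have "{p 0, p l} \<in> edges C" using adj'[of l] pk l by simp
    moreover have "p (Suc 0) \<noteq> p l" using inj[of "Suc 0" l] l2 l by auto
    ultimately have "incident_edges C (p 0) = {{p 0, p (Suc 0)}, {p 0, p l}}"
      using inc[OF adj[of 0]] by blast
    then show ?thesis using 0 pk l by (simp add: e_def pre_def insert_commute)
  next
    case (Suc i')
    then show ?thesis
      using inc[OF adj[of "Suc i'"] adj'[of i']] turn[of i']
      by (simp add: e_def pre_def insert_commute)
  qed
  have pre: "pre i < k" if "i < k" for i using that l by (auto simp: pre_def split: nat.split)
  \<comment> \<open>The visited vertices are closed under adjacency, so connectedness makes them all
    of \<open>verts C\<close>.\<close>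
  have closed: "w \<in> p ` {..<k}" if vw: "{v, w} \<in> edges C" "v \<in> p ` {..<k}" for v w
  proof -
    obtain i where i: "i < k" "v = p i" using vw(2) by auto
    have "{v, w} \<in> incident_edges C (p i)" using vw(1) i(2) by (simp add: incident_edges_def)
    then have "{v, w} \<in> {e i, e (pre i)}" unfolding at[OF i(1)] .
    then have "w \<in> {p i, p (Suc i), p (pre i), p (Suc (pre i))}"
      by (auto simp: e_def doubleton_eq_iff)
    moreover have "p (Suc i) \<in> p ` {..<k}" if "i < k" for i
      using that pk by (metis Suc_lessI gr_zeroI imageI lessThan_iff not_less0)
    ultimately show ?thesis using i(1) pre[OF i(1)] by auto
  qed
  have vertsp: "v \<in> p ` {..<k}" if "v \<in> verts C" for v
  proof -
    have "(p 0, v) \<in> {(x, y). {x, y} \<in> edges C}\<^sup>*"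
      using conn that v0 p0 by (auto simp: connected_graph_def)
    then show ?thesis
      by (induction rule: rtrancl_induct) (use closed j in auto)
  qed
  \<comment> \<open>Distinct tails force equal edges to be traversed in opposite directions;
    distinctness of the vertices then makes the two steps consecutive, so the walk would turn
    back.\<close>
  have inje: "inj_on e {..<k}"
  proof (rule linorder_inj_onI)
    fix a b assume ab: "a < b" "a \<in> {..<k}" "b \<in> {..<k}"
    show "e a \<noteq> e b"
    proof
      assume "e a = e b"
      moreover have "p a \<noteq> p b" using inj[of a b] ab by auto
      ultimately have pp: "p a = p (Suc b)" "p (Suc a) = p b"
        by (auto simp: e_def doubleton_eq_iff)
      then have "Suc a = b" using inj[of "Suc a" b] ab by auto
      then show False using turn[of a] pp by simp
    qed
  qed auto
  have "edges C = e ` {..<k}"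
  proof
    show "edges C \<subseteq> e ` {..<k}"
    proof
      fix f assume f: "f \<in> edges C"
      then obtain v where v: "v \<in> f" "v \<in> verts C"
        using simple by (fastforce simp: simple_graph_def card_2_iff)
      then obtain i where i: "i < k" "v = p i" using vertsp by blast
      have "f \<in> incident_edges C (p i)" using f v i by (simp add: incident_edges_def)
      then have "f \<in> {e i, e (pre i)}" unfolding at[OF i(1)] .
      then show "f \<in> e ` {..<k}" using i pre by auto
    qed
  qed (use adj in \<open>auto simp: e_def\<close>)
  then have evk: "even k" using even inje by (simp add: card_image)
  define c where "c f = even (inv_into {..<k} e f)" for f
  have c: "c (e i) = even i" if "i < k" for i
    using that inje by (simp add: c_def inv_into_f_f)
  show ?thesis
  proof (rule that[of c])
    fix v assume "v \<in> verts C"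
    then obtain i where i: "i < k" "v = p i" using vertsp by blast
    \<comment> \<open>Away from the start the indices are consecutive. At index 0 the other edge has
      index \<open>k - 1\<close>, which is odd because \<open>k\<close> is even.\<close>
    have "c (e i) \<noteq> c (e (pre i))"
      using c[OF i(1)] c[OF pre[OF i(1)]] evk l by (auto simp: pre_def split: nat.splits)
    then show "\<exists>e f. incident_edges C v = {e, f} \<and> c e \<noteq> c f" using at[OF i(1)] i(2) by blast
  qed
qed

section \<open>Colouring by the members of an oriented cover\<close>

text \<open>An edge is coloured by the member of the cover that leaves its end in \<open>X\<close>.
  With the other part in place of \<open>X\<close> this is the second colouring, so each fact has to
  be proved for one side only.\<close>

definition tail_colouring ::
  "'b set \<Rightarrow> ('b \<Rightarrow> ('a \<times> 'a) set) \<Rightarrow> 'a set \<Rightarrow> ('a set \<Rightarrow> 'b) \<Rightarrow> bool" where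
  "tail_colouring I A X t \<longleftrightarrow> (\<forall>i\<in>I. \<forall>x\<in>X. \<forall>y. (x, y) \<in> A i \<longrightarrow> t {x, y} = i)"

text \<open>The indices are the members of the cover, with \<open>A i\<close> the arcs of member
  \<open>i\<close>. \<open>arc_covered\<close> is the double cover read per direction: an edge
  covered twice, in opposite directions, has each of its two arcs in exactly one member.\<close>

locale oriented_cover =
  fixes E :: "'a set set" and I :: "'b set" and A :: "'b \<Rightarrow> ('a \<times> 'a) set"
  assumes arc_edge: "i \<in> I \<Longrightarrow> (u, v) \<in> A i \<Longrightarrow> {u, v} \<in> E"
    and arc_asym: "i \<in> I \<Longrightarrow> (u, v) \<in> A i \<Longrightarrow> (v, u) \<notin> A i"
    and arc_out: "i \<in> I \<Longrightarrow> (u, v) \<in> A i \<Longrightarrow> \<exists>w. (v, w) \<in> A i"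
    and arc_in: "i \<in> I \<Longrightarrow> (u, v) \<in> A i \<Longrightarrow> \<exists>w. (w, u) \<in> A i"
    and out_unique: "i \<in> I \<Longrightarrow> (u, v) \<in> A i \<Longrightarrow> (u, w) \<in> A i \<Longrightarrow> v = w"
    and in_unique: "i \<in> I \<Longrightarrow> (u, v) \<in> A i \<Longrightarrow> (w, v) \<in> A i \<Longrightarrow> u = w"
    and arc_covered: "{u, v} \<in> E \<Longrightarrow> \<exists>!i. i \<in> I \<and> (u, v) \<in> A i"
begin

text \<open>An edge has only one end in \<open>X\<close>, hence only one arc with tail in
  \<open>X\<close>, and that arc belongs to only one member.\<close>

lemma tail_colouring_exists:
  assumes "X \<inter> Y = {}" and "\<forall>e\<in>E. \<exists>x\<in>X. \<exists>y\<in>Y. e = {x, y}"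
  shows "\<exists>t. tail_colouring I A X t"
proof -
  define t where "t e = (THE i. i \<in> I \<and> (\<exists>x\<in>X. \<exists>y. e = {x, y} \<and> (x, y) \<in> A i))" for e
  have "t {x, y} = i" if "i \<in> I" "x \<in> X" "(x, y) \<in> A i" for i x y
    unfolding t_def
  proof (rule the_equality)
    fix j assume j: "j \<in> I \<and> (\<exists>x'\<in>X. \<exists>y'. {x, y} = {x', y'} \<and> (x', y') \<in> A j)"
    have xy: "{x, y} \<in> E" using that arc_edge by blast
    then have "y \<notin> X" using assms that(2) by (metis disjoint_iff doubleton_eq_iff)
    then have "(x, y) \<in> A j" using j by (auto simp: doubleton_eq_iff)
    then show "j = i" using arc_covered[OF xy] that j by blast
  qed (use that in blast)
  then show ?thesis by (auto simp: tail_colouring_def)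
qed

context
  fixes X Y t s
  assumes disjoint: "X \<inter> Y = {}" and crossing: "\<forall>e\<in>E. \<exists>x\<in>X. \<exists>y\<in>Y. e = {x, y}"
    and t: "tail_colouring I A X t" and s: "tail_colouring I A Y s"
begin

lemma tail_arc:
  assumes "e \<in> E"
  obtains x y where "x \<in> X" "y \<in> Y" "e = {x, y}" "t e \<in> I" "(x, y) \<in> A (t e)"
proof -
  obtain x y where xy: "x \<in> X" "y \<in> Y" "e = {x, y}" using crossing assms by blast
  obtain i where "i \<in> I" "(x, y) \<in> A i" using arc_covered assms xy(3) by blast
  with t xy that show ?thesis by (auto simp: tail_colouring_def)
qed

text \<open>Because the parts are disjoint, a shared vertex is a common tail or a common head of the
  two colouring arcs. A member leaves and enters a vertex at most once.\<close>

lemma tail_colouring_proper: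
  assumes "e \<in> E" "f \<in> E" "e \<inter> f \<noteq> {}" "t e = t f"
  shows "e = f"
proof -
  obtain x y where e: "x \<in> X" "y \<in> Y" "e = {x, y}" "t e \<in> I" "(x, y) \<in> A (t e)"
    using tail_arc assms(1) by blast
  obtain x' y' where f: "x' \<in> X" "y' \<in> Y" "f = {x', y'}" "t f \<in> I" "(x', y') \<in> A (t f)"
    using tail_arc assms(2) by blast
  have "x = x' \<or> y = y'" using e f assms(3) disjoint by auto
  then show ?thesis using e f assms(4) out_unique in_unique by metis
qed

text \<open>A member that colours an edge at \<open>v\<close> passes through \<open>v\<close>. Its
  arc at \<open>v\<close> with tail in \<open>Y\<close> is the one entering \<open>v\<close> if
  \<open>v\<close> is in \<open>X\<close>, and the one leaving \<open>v\<close> otherwise.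
  Exchanging the parts gives the reverse inclusion.\<close>

lemma tail_colours_subset: "t ` {e \<in> E. v \<in> e} \<subseteq> s ` {e \<in> E. v \<in> e}"
proof
  fix i assume "i \<in> t ` {e \<in> E. v \<in> e}"
  then obtain e where e: "e \<in> E" "v \<in> e" "i = t e" by blast
  then obtain x y where xy: "x \<in> X" "y \<in> Y" "e = {x, y}" "i \<in> I" "(x, y) \<in> A i"
    using tail_arc by metis
  have "\<exists>u w. u \<in> Y \<and> v \<in> {u, w} \<and> (u, w) \<in> A i"
  proof (cases "v = x")
    case True
    obtain u where u: "(u, x) \<in> A i" using arc_in xy by blast
    then have "u \<in> Y" using bspec[OF crossing arc_edge[OF xy(4) u]] xy(1) disjoint
      by (auto simp: doubleton_eq_iff)
    then show ?thesis using u True by blast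
  next
    case False
    then show ?thesis using arc_out[OF xy(4,5)] xy e(2) by blast
  qed
  then obtain u w where uw: "u \<in> Y" "v \<in> {u, w}" "(u, w) \<in> A i" by blast
  then have "s {u, w} = i" "{u, w} \<in> E"
    using s xy(4) arc_edge by (auto simp: tail_colouring_def)
  then show "i \<in> s ` {e \<in> E. v \<in> e}" using uw(2) by blast
qed

text \<open>The second colour is the member that traverses the edge the other way, and no member
  contains both arcs of an edge.\<close>

lemma tail_colours_differ:
  assumes "e \<in> E"
  shows "t e \<noteq> s e"
proof -
  obtain x y where e: "x \<in> X" "y \<in> Y" "e = {x, y}" "t e \<in> I" "(x, y) \<in> A (t e)"
    using tail_arc assms by blast
  have yx: "e = {y, x}" using e(3) by blast
  obtain j where j: "j \<in> I" "(y, x) \<in> A j" using arc_covered[of y x] assms yx by blast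
  then have "s e = j" unfolding yx using s e(2) by (simp add: tail_colouring_def)
  then show ?thesis using arc_asym[OF j] e(5) by metis
qed

end

lemma simultaneous_colouring:
  assumes XY: "X \<inter> Y = {}" and cr: "\<forall>e\<in>E. \<exists>x\<in>X. \<exists>y\<in>Y. e = {x, y}"
  obtains t s :: "'a set \<Rightarrow> 'b"
  where "\<And>e f. e \<in> E \<Longrightarrow> f \<in> E \<Longrightarrow> e \<inter> f \<noteq> {} \<Longrightarrow> t e = t f \<Longrightarrow> e = f"
    and "\<And>e f. e \<in> E \<Longrightarrow> f \<in> E \<Longrightarrow> e \<inter> f \<noteq> {} \<Longrightarrow> s e = s f \<Longrightarrow> e = f"
    and "\<And>v. t ` {e \<in> E. v \<in> e} = s ` {e \<in> E. v \<in> e}"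
    and "\<And>e. e \<in> E \<Longrightarrow> t e \<noteq> s e"
proof -
  have YX: "Y \<inter> X = {}" using XY by blast
  have cr': "\<forall>e\<in>E. \<exists>y\<in>Y. \<exists>x\<in>X. e = {y, x}"
    using cr by (metis insert_commute)
  obtain t where t: "tail_colouring I A X t" using tail_colouring_exists XY cr by blast
  obtain s where s: "tail_colouring I A Y s" using tail_colouring_exists YX cr' by blast
  show ?thesis
  proof (rule that[of t s])
    show "t ` {e \<in> E. v \<in> e} = s ` {e \<in> E. v \<in> e}" for v
      using tail_colours_subset[OF XY cr t s, of v] tail_colours_subset[OF YX cr' s t, of v]
      by blast
  qed (erule (3) tail_colouring_proper[OF XY cr t s],
      erule (3) tail_colouring_proper[OF YX cr' s t], erule tail_colours_differ[OF XY cr t s])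
qed

end

text \<open>The colours are circuits paired with their orientations. Passing from the multiset
  \<open>D\<close> to its set of elements merges nothing: two equal pairs covering an edge would
  need one orientation with both arcs of that edge.\<close>

lemma oriented_cycle_double_cover_arcs:
  assumes "oriented_cycle_double_cover H M"
  obtains I :: "('a graph \<times> ('a \<times> 'a) set) set" where "oriented_cover (edges H) I snd"
proof -
  obtain D where circ: "\<forall>C\<in>#M. circuit H C" and DM: "image_mset fst D = M"
    and cyc: "\<forall>X\<in>#D. cyclic_orientation (fst X) (snd X)"
    and cover: "\<And>u v. {u, v} \<in> edges H \<Longrightarrow>
           (\<exists>X Y. {#Z \<in># D. {u, v} \<in> edges (fst Z)#} = {#X, Y#} \<and>
                  (u, v) \<in> snd X \<and> (v, u) \<in> snd Y)"
    using assms unfolding oriented_cycle_double_cover_def by blast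
  have cy: "cyclic_orientation (fst Z) (snd Z)" and sub: "edges (fst Z) \<subseteq> edges H"
    and simple: "simple_graph (fst Z)" if "Z \<in># D" for Z
    using that cyc circ DM by (auto simp: circuit_def subgraph_def)
  have arc: "{u, v} \<in> edges (fst Z)" if "Z \<in># D" "(u, v) \<in> snd Z" for Z u v
    using cy[OF that(1)] that(2) by (auto simp: cyclic_orientation_def)
  have ends: "u \<in> verts (fst Z)" "v \<in> verts (fst Z)" if "Z \<in># D" "(u, v) \<in> snd Z" for Z u v
    using arc[OF that] simple[OF that(1)] by (auto simp: simple_graph_def)
  have asym: "(v, u) \<notin> snd Z" if "Z \<in># D" "(u, v) \<in> snd Z" for Z u v
    using cy[OF that(1)] that(2) by (auto simp: cyclic_orientation_def)
  have unique: "\<exists>!Z. Z \<in># D \<and> (u, v) \<in> snd Z" if uv: "{u, v} \<in> edges H" for u v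
  proof -
    obtain X Y where XY: "{#Z \<in># D. {u, v} \<in> edges (fst Z)#} = {#X, Y#}"
      "(u, v) \<in> snd X" "(v, u) \<in> snd Y" using cover[OF uv] by blast
    have set: "Z \<in># D \<and> {u, v} \<in> edges (fst Z) \<longleftrightarrow> Z = X \<or> Z = Y" for Z
      using arg_cong[OF XY(1), of "\<lambda>N. Z \<in># N"] by simp
    show ?thesis
    proof (rule ex1I[of _ X])
      fix Z assume Z: "Z \<in># D \<and> (u, v) \<in> snd Z"
      \<comment> \<open>Only \<open>X\<close> and \<open>Y\<close> cover the edge, and
        \<open>Y\<close> already traverses it from \<open>v\<close> to \<open>u\<close>.\<close>
      then have "Z = X \<or> Z = Y" using set arc by blast
      then show "Z = X" using Z XY(3) asym by blast
    qed (use set XY in blast)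
  qed
  have out: "\<exists>!w. (v, w) \<in> snd Z" and into: "\<exists>!w. (w, v) \<in> snd Z"
    if "Z \<in># D" "v \<in> verts (fst Z)" for Z v
    using cy[OF that(1)] that(2) by (auto simp: cyclic_orientation_def)
  have "oriented_cover (edges H) (set_mset D) snd"
  proof
    fix Z u v w assume Z: "Z \<in># D" and a: "(u, v) \<in> snd Z"
    show "{u, v} \<in> edges H" using arc[OF Z a] sub[OF Z] by blast
    show "(v, u) \<notin> snd Z" using asym[OF Z a] .
    show "\<exists>w. (v, w) \<in> snd Z" "\<exists>w. (w, u) \<in> snd Z"
      using out[OF Z] into[OF Z] ends[OF Z a] by blast+
    show "(u, w) \<in> snd Z \<Longrightarrow> v = w" "(w, v) \<in> snd Z \<Longrightarrow> u = w"
      using out[OF Z] into[OF Z] ends[OF Z a] a by blast+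
  qed (use unique in blast)
  then show ?thesis by (rule that)
qed

section \<open>Numbering the colours and joining the two colourings\<close>

text \<open>Colours may be taken from any type: finitely many occur, and an injective numbering of
  those used by either colouring preserves all conditions.\<close>

lemma two_simultaneous_edge_coloring_transfer:
  fixes a1 a2 :: "'a set \<Rightarrow> 'b"
  assumes fin: "finite (edges G)"
    and proper1: "\<And>e f. e \<in> edges G \<Longrightarrow> f \<in> edges G \<Longrightarrow> e \<inter> f \<noteq> {} \<Longrightarrow> a1 e = a1 f \<Longrightarrow> e = f"
    and proper2: "\<And>e f. e \<in> edges G \<Longrightarrow> f \<in> edges G \<Longrightarrow> e \<inter> f \<noteq> {} \<Longrightarrow> a2 e = a2 f \<Longrightarrow> e = f"
    and colours: "\<And>v. v \<in> verts G \<Longrightarrow> a1 ` incident_edges G v = a2 ` incident_edges G v"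
    and differ: "\<And>e. e \<in> edges G \<Longrightarrow> a1 e \<noteq> a2 e"
  shows "\<exists>l c1 c2. two_simultaneous_edge_coloring G l c1 c2"
proof -
  let ?S = "a1 ` edges G \<union> a2 ` edges G"
  have "finite ?S" using fin by simp
  then obtain g and n :: nat where g: "g ` ?S = {i. i < n}" "inj_on g ?S"
    using finite_imp_inj_to_nat_seg by metis
  \<comment> \<open>\<open>g\<close> numbers from 0, whereas colours start at 1.\<close>
  define h where "h x = Suc (g x)" for x
  have inj: "x = y" if "h x = h y" "x \<in> ?S" "y \<in> ?S" for x y
    using inj_onD[OF g(2) _ that(2,3)] that(1) by (simp add: h_def)
  have range: "h x \<in> {1..n}" if "x \<in> ?S" for x
  proof -
    have "g x \<in> {i. i < n}" using imageI[OF that, of g] unfolding g(1) .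
    then show ?thesis by (simp add: h_def)
  qed
  have "two_simultaneous_edge_coloring G n (h \<circ> a1) (h \<circ> a2)"
    unfolding two_simultaneous_edge_coloring_def proper_edge_coloring_def
  proof (intro conjI ballI impI)
    fix v assume "v \<in> verts G"
    then show "(h \<circ> a1) ` incident_edges G v = (h \<circ> a2) ` incident_edges G v"
      unfolding image_comp[symmetric] using colours by simp
  next
    fix e f assume "e \<in> edges G" "f \<in> edges G" "e \<noteq> f \<and> e \<inter> f \<noteq> {}"
    then show "(h \<circ> a1) e \<noteq> (h \<circ> a1) f" "(h \<circ> a2) e \<noteq> (h \<circ> a2) f"
      using proper1[of e f] proper2[of e f] inj[of "a1 e" "a1 f"] inj[of "a2 e" "a2 f"] by auto
  next
    fix e assume "e \<in> edges G"
    then show "(h \<circ> a1) e \<noteq> (h \<circ> a2) e" using differ inj[of "a1 e" "a2 e"] by auto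
  qed (use range in auto)
  then show ?thesis by blast
qed

theorem theorem3p5:
  fixes G C :: "'a graph"
  assumes "simple_graph G"
    and "even_hamiltonian_circuit G C"
    and "bipartite (delete_edges G (edges C))"
    and "\<exists>M. oriented_cycle_double_cover (delete_edges G (edges C)) M"
  shows "\<exists>l c1 c2. two_simultaneous_edge_coloring G l c1 c2"
proof -
  let ?E = "edges (delete_edges G (edges C))"
  have E: "?E = edges G - edges C" by (simp add: delete_edges_def)
  have circ: "circuit G C" and VC: "verts C = verts G" and "even (card (edges C))"
    using assms(2) by (auto simp: even_hamiltonian_circuit_def)
  then obtain c :: "'a set \<Rightarrow> bool" where
    c: "\<And>v. v \<in> verts C \<Longrightarrow> \<exists>e f. incident_edges C v = {e, f} \<and> c e \<noteq> c f"
    using even_circuit_alternating by metis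
  have CG: "edges C \<subseteq> edges G" using circ by (auto simp: circuit_def subgraph_def)
  have vert: "v \<in> verts G" if "v \<in> e" "e \<in> edges G" for v e
    using that assms(1) by (auto simp: simple_graph_def)
  obtain I :: "('a graph \<times> ('a \<times> 'a) set) set" where cover: "oriented_cover ?E I snd"
    using assms(4) oriented_cycle_double_cover_arcs by metis
  obtain X Y where XY: "X \<inter> Y = {}" "\<forall>e\<in>?E. \<exists>x\<in>X. \<exists>y\<in>Y. e = {x, y}"
    using assms(3) unfolding bipartite_def by - (elim exE conjE, rule that)
  obtain t s :: "'a set \<Rightarrow> 'a graph \<times> ('a \<times> 'a) set" where
    t: "\<And>e f. e \<in> ?E \<Longrightarrow> f \<in> ?E \<Longrightarrow> e \<inter> f \<noteq> {} \<Longrightarrow> t e = t f \<Longrightarrow> e = f"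
    and s: "\<And>e f. e \<in> ?E \<Longrightarrow> f \<in> ?E \<Longrightarrow> e \<inter> f \<noteq> {} \<Longrightarrow> s e = s f \<Longrightarrow> e = f"
    and ts: "\<And>v. t ` {e \<in> ?E. v \<in> e} = s ` {e \<in> ?E. v \<in> e}"
    and differ: "\<And>e. e \<in> ?E \<Longrightarrow> t e \<noteq> s e"
    by (rule oriented_cover.simultaneous_colouring[OF cover XY]) blast
  \<comment> \<open>The sum type keeps the two colours of the circuit apart from the members of the
    cover.\<close>
  define a1 where "a1 e = (if e \<in> edges C then Inr (c e) else Inl (t e))" for e
  define a2 where "a2 e = (if e \<in> edges C then Inr (\<not> c e) else Inl (s e))" for e
  \<comment> \<open>At a shared vertex \<open>C\<close> has just two edges, and \<open>c\<close>
    separates them.\<close>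
  have alt: "e = f" if ef: "e \<in> edges C" "f \<in> edges C" "e \<inter> f \<noteq> {}" "c e = c f" for e f
  proof -
    obtain v where v: "v \<in> e" "v \<in> f" using ef(3) by blast
    then have "v \<in> verts C" using vert CG VC ef(1) by blast
    moreover have "e \<in> incident_edges C v" "f \<in> incident_edges C v"
      using v ef by (auto simp: incident_edges_def)
    ultimately show ?thesis using c[of v] ef(4) by auto
  qed
  show ?thesis
  proof (rule two_simultaneous_edge_coloring_transfer[of G a1 a2])
    have "edges G \<subseteq> Pow (verts G)" "finite (verts G)"
      using assms(1) by (auto simp: simple_graph_def)
    then show "finite (edges G)" by (metis finite_Pow_iff finite_subset)
  next
    fix e f assume "e \<in> edges G" "f \<in> edges G" "e \<inter> f \<noteq> {}" "a1 e = a1 f"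
    then show "e = f" using alt[of e f] t[of e f] E by (auto simp: a1_def split: if_splits)
  next
    fix e f assume "e \<in> edges G" "f \<in> edges G" "e \<inter> f \<noteq> {}" "a2 e = a2 f"
    then show "e = f" using alt[of e f] s[of e f] E by (auto simp: a2_def split: if_splits)
  next
    fix e assume "e \<in> edges G"
    then show "a1 e \<noteq> a2 e" using differ[of e] E by (auto simp: a1_def a2_def)
  next
    fix v assume v: "v \<in> verts G"
    have split: "incident_edges G v = incident_edges C v \<union> {e \<in> ?E. v \<in> e}"
      using CG E by (auto simp: incident_edges_def)
    have "a1 ` incident_edges C v = Inr ` c ` incident_edges C v"
      "a2 ` incident_edges C v = Inr ` Not ` c ` incident_edges C v"
      by (force simp: a1_def a2_def incident_edges_def)+
    \<comment> \<open>Since \<open>C\<close> is Hamiltonian, both truth values occur at every vertex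
      of \<open>G\<close>, so exchanging them leaves the set of colours there unchanged.\<close>
    moreover have "c ` incident_edges C v = UNIV" using c[of v] v VC by (auto simp: UNIV_bool)
    ultimately have "a1 ` incident_edges C v = a2 ` incident_edges C v"
      by (auto simp: UNIV_bool)
    moreover have "a1 ` {e \<in> ?E. v \<in> e} = Inl ` t ` {e \<in> ?E. v \<in> e}"
      "a2 ` {e \<in> ?E. v \<in> e} = Inl ` s ` {e \<in> ?E. v \<in> e}"
      using E by (force simp: a1_def a2_def)+
    ultimately show "a1 ` incident_edges G v = a2 ` incident_edges G v"
      by (simp only: split image_Un ts)
  qed
qed

end
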